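(* Let $a_n=|B_n(123,213)|$. Then $a_n=1$ if $n=1$ or $n$ is even, and $a_n=2$ otherwise (i.e. for odd $n\ge 3$).
   Context: A permutation $\sigma\in S_n$ is written as $\sigma(1)\cdots\sigma(n)$. An index $i\in[n-1]$ is an ascent if $\sigma(i)<\sigma(i+1)$ and a descent if $\sigma(i)>\sigma(i+1)$. A ballot permutation is a permutation such that every prefix $\sigma(1)\cdots\sigma(p)$ has at least as many ascents as descents. $\sigma$ contains a pattern $\pi\in S_k$ if some subsequence $\sigma(c_1)\cdots\sigma(c_k)$ with $c_1<\dots<c_k$ is order-isomorphic to $\pi$, and avoids $\pi$ otherwise. $B_n(\pi_1,\dots,\pi_m)$ denotes the set of ballot permutations of length $n$ avoiding all of $\pi_1,\dots,\pi_m$. *)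

theory Defs
  imports "HOL-Library.Sublist" "HOL-Combinatorics.Multiset_Permutations"
begin

text \<open>
  A permutation \<open>\<sigma>\<close> in \<open>S\<^sub>n\<close> is represented by its one-line notation
  \<open>\<sigma>(1) \<dots> \<sigma>(n)\<close>, a list in \<open>permutations_of_set {1..n}\<close>; thus \<open>\<sigma>(i)\<close> is \<open>\<sigma> ! (i - 1)\<close>.
\<close>

definition ascents :: "nat list \<Rightarrow> nat set" where
  "ascents w = {i \<in> {1..<length w}. w ! (i - 1) < w ! i}"

definition descents :: "nat list \<Rightarrow> nat set" where
  "descents w = {i \<in> {1..<length w}. w ! (i - 1) > w ! i}"

definition ballot :: "nat list \<Rightarrow> bool" where
  "ballot w \<longleftrightarrow>
     (\<forall>p \<in> {1..length w}. card (ascents (take p w)) \<ge> card (descents (take p w)))"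

definition order_isomorphic :: "nat list \<Rightarrow> nat list \<Rightarrow> bool" where
  "order_isomorphic u v \<longleftrightarrow> length u = length v \<and>
     (\<forall>i < length u. \<forall>j < length u. u ! i < u ! j \<longleftrightarrow> v ! i < v ! j)"

definition contains_pattern :: "nat list \<Rightarrow> nat list \<Rightarrow> bool" where
  "contains_pattern w \<pi> \<longleftrightarrow> (\<exists>u. subseq u w \<and> order_isomorphic u \<pi>)"

definition avoids_pattern :: "nat list \<Rightarrow> nat list \<Rightarrow> bool" where
  "avoids_pattern w \<pi> \<longleftrightarrow> \<not> contains_pattern w \<pi>"

definition ballot_avoiders :: "nat \<Rightarrow> nat list set \<Rightarrow> nat list set" where
  "ballot_avoiders n P =
     {w \<in> permutations_of_set {1..n}. ballot w \<and> (\<forall>\<pi> \<in> P. avoids_pattern w \<pi>)}"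

end

theory Submission
  imports Defs
begin

text \<open>
  Avoiding 123 and 213 means that every entry exceeds at most one earlier entry. In particular
  there are no two consecutive ascents, so the ballot condition forces ascents and descents to
  alternate, starting with an ascent. The bottom of each ascent is then the only earlier entry
  that its top exceeds, so each ascending pair lies below everything before it. This fixes the
  relative order of all entries, except that for odd \<open>n \<ge> 3\<close> the last entry may lie above or below
  the bottom of the last ascending pair.
\<close>

section \<open>Pattern containment in terms of positions\<close>

lemma subseq_Cons_iff_nth:
  "subseq (x # u) w \<longleftrightarrow> (\<exists>i < length w. w ! i = x \<and> subseq u (drop (Suc i) w))"
proof
  assume "subseq (x # u) w"
  then obtain us vs where "w = us @ x # vs" "subseq u vs"
    by (auto dest!: list_emb_ConsD)
  then show "\<exists>i < length w. w ! i = x \<and> subseq u (drop (Suc i) w)"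
    by (intro exI[of _ "length us"]) auto
next
  assume "\<exists>i < length w. w ! i = x \<and> subseq u (drop (Suc i) w)"
  then obtain i where i: "i < length w" "w ! i = x" "subseq u (drop (Suc i) w)"
    by blast
  then have "subseq (x # u) (take i w @ x # drop (Suc i) w)"
    by (intro list_emb_append2) auto
  then show "subseq (x # u) w"
    using i id_take_nth_drop by metis
qed

lemma subseq_triple_iff:
  "subseq [a, b, c] w \<longleftrightarrow>
     (\<exists>i j k. i < j \<and> j < k \<and> k < length w \<and> w ! i = a \<and> w ! j = b \<and> w ! k = c)"
proof
  assume "subseq [a, b, c] w"
  then obtain i where i: "i < length w" "w ! i = a" "subseq [b, c] (drop (Suc i) w)"
    unfolding subseq_Cons_iff_nth[of a] by blast
  \<comment> \<open>From here on, the witnesses are offsets into the suffix left after the previous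
    letter, so the actual positions in \<open>w\<close> are \<open>Suc i + j\<close> and
    \<open>Suc (Suc i + j) + k\<close>.\<close>
  then obtain j where j: "j < length w - Suc i" "w ! (Suc i + j) = b"
      "subseq [c] (drop (Suc (Suc i + j)) w)"
    unfolding subseq_Cons_iff_nth[of b] by (auto simp: add.commute)
  then obtain k where k: "k < length w - Suc (Suc i + j)" "w ! (Suc (Suc i + j) + k) = c"
    unfolding subseq_Cons_iff_nth[of c] by auto
  show "\<exists>i j k. i < j \<and> j < k \<and> k < length w \<and> w ! i = a \<and> w ! j = b \<and> w ! k = c"
    using i j k by (intro exI[of _ i] exI[of _ "Suc i + j"] exI[of _ "Suc (Suc i + j) + k"]) simp
next
  assume "\<exists>i j k. i < j \<and> j < k \<and> k < length w \<and> w ! i = a \<and> w ! j = b \<and> w ! k = c"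
  then obtain i j k where ijk: "i < j" "j < k" "k < length w" "w ! i = a" "w ! j = b" "w ! k = c"
    by blast
  have "subseq [c] (drop (Suc j) w)"
    unfolding subseq_Cons_iff_nth using ijk by (intro exI[of _ "k - Suc j"]) simp
  then have "subseq [b, c] (drop (Suc i) w)"
    unfolding subseq_Cons_iff_nth[of b] using ijk
    by (intro exI[of _ "j - Suc i"]) (simp del: subseq_singleton_left)
  then show "subseq [a, b, c] w"
    unfolding subseq_Cons_iff_nth[of a] using ijk by (intro exI[of _ i]) simp
qed

lemma order_isomorphic_123: "order_isomorphic u [1, 2, 3] \<longleftrightarrow> (\<exists>a b c. u = [a, b, c] \<and> a < b \<and> b < c)"
  unfolding order_isomorphic_def
  by (auto simp: numeral_3_eq_3 length_Suc_conv All_less_Suc less_Suc_eq)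

lemma order_isomorphic_213: "order_isomorphic u [2, 1, 3] \<longleftrightarrow> (\<exists>a b c. u = [a, b, c] \<and> b < a \<and> a < c)"
  unfolding order_isomorphic_def
  by (auto simp: numeral_3_eq_3 length_Suc_conv All_less_Suc less_Suc_eq)

lemma contains_123_iff:
  "contains_pattern w [1, 2, 3] \<longleftrightarrow>
     (\<exists>i j k. i < j \<and> j < k \<and> k < length w \<and> w ! i < w ! j \<and> w ! j < w ! k)"
proof -
  have "contains_pattern w [1, 2, 3] \<longleftrightarrow> (\<exists>a b c. subseq [a, b, c] w \<and> a < b \<and> b < c)"
    unfolding contains_pattern_def order_isomorphic_123 by blast
  then show ?thesis
    unfolding subseq_triple_iff by metis
qed

lemma contains_213_iff:
  "contains_pattern w [2, 1, 3] \<longleftrightarrow>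
     (\<exists>i j k. i < j \<and> j < k \<and> k < length w \<and> w ! j < w ! i \<and> w ! i < w ! k)"
proof -
  have "contains_pattern w [2, 1, 3] \<longleftrightarrow> (\<exists>a b c. subseq [a, b, c] w \<and> b < a \<and> a < c)"
    unfolding contains_pattern_def order_isomorphic_213 by blast
  then show ?thesis
    unfolding subseq_triple_iff by metis
qed

text \<open>In both patterns the last letter is the largest, and 12 and 21 exhaust the orders of the
  first two. Distinctness excludes a tie between those two, so together the patterns forbid exactly
  a third entry above two earlier ones.\<close>

lemma avoids_123_213_iff:
  assumes "distinct w"
  shows "avoids_pattern w [1, 2, 3] \<and> avoids_pattern w [2, 1, 3] \<longleftrightarrow>
    (\<forall>i j k. i < j \<longrightarrow> j < k \<longrightarrow> k < length w \<longrightarrow> w ! i < w ! k \<longrightarrow> \<not> w ! j < w ! k)"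
    (is "?L \<longleftrightarrow> ?R")
proof
  assume L: ?L
  show ?R
  proof (intro allI impI notI)
    fix i j k
    assume ijk: "i < j" "j < k" "k < length w" "w ! i < w ! k" "w ! j < w ! k"
    then have "w ! i \<noteq> w ! j"
      using assms by (simp add: nth_eq_iff_index_eq)
    then consider "w ! i < w ! j" | "w ! j < w ! i"
      by linarith
    then show False
      using L ijk unfolding avoids_pattern_def contains_123_iff contains_213_iff
      by cases blast+
  qed
next
  assume R: ?R
  show ?L
    unfolding avoids_pattern_def contains_123_iff contains_213_iff
    using R by (meson order.strict_trans)
qed

section \<open>Ballot condition, alternation and the resulting order of the entries\<close>

definition alternating :: "nat list \<Rightarrow> bool" where
  "alternating w \<longleftrightarrow> (\<forall>i. Suc i < length w \<longrightarrow> (w ! i < w ! Suc i \<longleftrightarrow> even i))"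

text \<open>Every descent is immediately preceded by an ascent of its own, so shifting positions
  down by one injects the descents of a prefix into its ascents.\<close>

lemma alternating_imp_ballot:
  assumes "alternating w"
  shows "ballot w"
  unfolding ballot_def
proof
  fix p assume p: "p \<in> {1..length w}"
  let ?A = "ascents (take p w)" and ?D = "descents (take p w)"
  \<comment> \<open>\<open>ascents\<close> uses 1-based positions, whereas
    \<open>alternating\<close> refers to the 0-based index \<open>i - 1\<close> of the left entry;
    hence even turns into odd.\<close>
  have step: "w ! (i - 1) < w ! i \<longleftrightarrow> odd i" if "i \<in> {1..<p}" for i
    using assms[unfolded alternating_def, rule_format, of "i - 1"] that p by auto
  have A: "?A = {i \<in> {1..<p}. odd i}"
    using step p by (auto simp: ascents_def)
  have D: "?D \<subseteq> {i \<in> {1..<p}. even i}"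
    using step p by (fastforce simp: descents_def)
  show "card ?D \<le> card ?A"
  proof (rule card_inj_on_le)
    show "inj_on (\<lambda>i. i - 1) ?D"
      using D by (fastforce simp: inj_on_def)
    show "(\<lambda>i. i - 1) ` ?D \<subseteq> ?A"
      using D unfolding A by (auto elim!: evenE dest!: subsetD) presburger
    show "finite ?A"
      unfolding A by simp
  qed
qed

text \<open>Strong induction on the index k of the left entry. If k is odd, the preceding step is an
  ascent and \<open>no_double\<close> forbids another. If k is even, the k earlier steps contain
  equally many ascents and descents, so a further descent would violate the ballot
  condition.\<close>

lemma ballot_imp_alternating:
  assumes "distinct w" "ballot w"
    and no_double: "\<And>i. Suc (Suc i) < length w \<Longrightarrow> w ! i < w ! Suc i \<Longrightarrow> \<not> w ! Suc i < w ! Suc (Suc i)"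
  shows "alternating w"
  unfolding alternating_def
proof (intro allI impI)
  fix k assume "Suc k < length w"
  then show "w ! k < w ! Suc k \<longleftrightarrow> even k"
  proof (induction k rule: less_induct)
    case (less k)
    show ?case
    proof (cases "even k")
      case False
      then obtain l where l: "k = Suc l" "even l"
        by (cases k) auto
      then show ?thesis
        using less.IH[of l] less.prems no_double[of l] by auto
    next
      case True
      let ?p = "Suc (Suc k)"
      let ?A = "ascents (take ?p w)" and ?D = "descents (take ?p w)"
      have step: "w ! (i - 1) < w ! i \<longleftrightarrow> odd i" if "1 \<le> i" "i \<le> k" for i
        using less.IH[of "i - 1"] less.prems that by auto
      have "w ! k < w ! Suc k"
      proof (rule ccontr)
        assume *: "\<not> w ! k < w ! Suc k"
        have A: "odd i \<and> i < k" if "i \<in> ?A" for i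
        proof -
          have i: "1 \<le> i" "i \<le> Suc k" "w ! (i - 1) < w ! i"
            using that by (auto simp: ascents_def)
          then have "i \<le> k"
            using * by (cases "i = Suc k") auto
          then have "odd i"
            using step i by auto
          then show ?thesis
            using \<open>i \<le> k\<close> True by (cases "i = k") auto
        qed
        have D: "i \<in> ?D" if "even i" "1 \<le> i" "i \<le> k" for i
        proof -
          have "w ! (i - 1) \<noteq> w ! i"
            using that less.prems assms(1) by (simp add: nth_eq_iff_index_eq)
          then show ?thesis
            using step[of i] that less.prems by (auto simp: descents_def)
        qed
        have "w ! k \<noteq> w ! Suc k"
          using less.prems assms(1) by (simp add: nth_eq_iff_index_eq)
        then have last: "Suc k \<in> ?D"
          using * less.prems by (auto simp: descents_def)
        have fin: "finite ?D"
          by (simp add: descents_def)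
        \<comment> \<open>An ascent i is odd and below k, so \<open>Suc i\<close> is even and at
          most k, hence a descent different from \<open>Suc k\<close>. The additional descent
          \<open>Suc k\<close> makes the inequality strict.\<close>
        have "card ?A \<le> card (?D - {Suc k})"
          by (rule card_inj_on_le[of Suc]) (use A D fin in force)+
        also have "\<dots> < card ?D"
          using last fin by (intro psubset_card_mono) auto
        also have "\<dots> \<le> card ?A"
          using assms(2) less.prems by (auto simp: ballot_def)
        finally show False by simp
      qed
      with True show ?thesis by simp
    qed
  qed
qed

text \<open>The exempted pair exists only for odd length at least 3: it consists of the bottom of
  the last ascending pair and the final entry. This is the one comparison that the ballot and
  avoidance conditions leave open.\<close>

definition layered :: "nat list \<Rightarrow> bool" where
  "layered w \<longleftrightarrow> (\<forall>i j. i < j \<longrightarrow> j < length w \<longrightarrow>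
     \<not> (even j \<and> Suc j = length w \<and> j = i + 2) \<longrightarrow>
     (w ! i < w ! j \<longleftrightarrow> even i \<and> j = Suc i))"

lemma layered_iff:
  assumes "distinct w"
  shows "layered w \<longleftrightarrow> ballot w \<and>
    (\<forall>i j k. i < j \<longrightarrow> j < k \<longrightarrow> k < length w \<longrightarrow> w ! i < w ! k \<longrightarrow> \<not> w ! j < w ! k)"
    (is "_ \<longleftrightarrow> _ \<and> ?R")
proof (intro iffI conjI)
  assume L: "layered w"
  then have "alternating w"
    by (auto simp: layered_def alternating_def)
  then show "ballot w"
    by (rule alternating_imp_ballot)
  show ?R
  proof (intro allI impI notI)
    fix i j k assume ijk: "i < j" "j < k" "k < length w" "w ! i < w ! k" "w ! j < w ! k"
    \<comment> \<open>Since k is not \<open>Suc i\<close>, only the exempted pair allows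
      \<open>w ! i < w ! k\<close>. Then j is the odd position between them, and the step from j to
      k must be a descent.\<close>
    then have "even k \<and> k = i + 2"
      using L[unfolded layered_def, rule_format, of i k] by auto
    then have "j = Suc i" "k = Suc j" "even i"
      using ijk by auto
    then show False
      using L[unfolded layered_def, rule_format, of j k] ijk by auto
  qed
next
  assume "ballot w \<and> ?R"
  then have b: "ballot w" and
    R: "\<And>i j k. i < j \<Longrightarrow> j < k \<Longrightarrow> k < length w \<Longrightarrow> w ! i < w ! k \<Longrightarrow> w ! j < w ! k \<Longrightarrow> False"
    by blast+
  have "\<not> w ! Suc i < w ! Suc (Suc i)" if "Suc (Suc i) < length w" "w ! i < w ! Suc i" for i
    using R[of i "Suc i" "Suc (Suc i)"] that by auto
  then have "alternating w"
    using ballot_imp_alternating assms b by blast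
  then have alt: "w ! i < w ! Suc i \<longleftrightarrow> even i" if "Suc i < length w" for i
    using that by (auto simp: alternating_def)
  \<comment> \<open>The top of an ascending pair already exceeds its own bottom, which uses up the
    single smaller earlier entry it may have.\<close>
  have odd_top: "\<not> w ! i < w ! j" if "Suc i < j" "j < length w" "odd j" for i j
  proof -
    have "i < j - 1" "j - 1 < j" "w ! (j - 1) < w ! j"
      using alt[of "j - 1"] that by auto
    then show ?thesis
      using R[of i "j - 1" j] that by auto
  qed
  show "layered w"
    unfolding layered_def
  proof (intro allI impI)
    fix i j assume ij: "i < j" "j < length w" "\<not> (even j \<and> Suc j = length w \<and> j = i + 2)"
    show "w ! i < w ! j \<longleftrightarrow> even i \<and> j = Suc i"
    proof (cases "j = Suc i")
      case True
      then show ?thesis using alt ij by auto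
    next
      case False
      have "\<not> w ! i < w ! j"
      proof (cases "odd j")
        case True
        then show ?thesis using odd_top ij False by auto
      next
        case even: False
        show ?thesis
        proof (cases "Suc j < length w")
          case True
          \<comment> \<open>Here j is the bottom of an ascending pair with top \<open>Suc j\<close>;
            an earlier entry below \<open>w ! j\<close> would be a second one below that
            top.\<close>
          then show ?thesis
            using alt[of j] R[of i j "Suc j"] even ij by auto
        next
          case last: False
          \<comment> \<open>The final entry has no top after it, so the comparison passes through
            the top at \<open>j - 1\<close>: it lies below \<open>w ! i\<close>, and the last step
            descends from it. This needs i to precede the last ascending pair, which the exemption
            ensures.\<close>
          then have "Suc i < j - 1"
            using ij False even by auto
          then have "\<not> w ! i < w ! (j - 1)" "\<not> w ! (j - 1) < w ! j"
            using odd_top[of i "j - 1"] alt[of "j - 1"] even ij by auto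
          then show ?thesis by simp
        qed
      qed
      with False show ?thesis by simp
    qed
  qed
qed

lemma ballot_avoiders_eq_layered:
  "ballot_avoiders n {[1, 2, 3], [2, 1, 3]} = {w \<in> permutations_of_set {1..n}. layered w}"
proof -
  have "ballot w \<and> (\<forall>\<pi> \<in> {[1, 2, 3], [2, 1, 3]}. avoids_pattern w \<pi>) \<longleftrightarrow> layered w"
    if "w \<in> permutations_of_set {1..n}" for w
    using layered_iff[of w] avoids_123_213_iff[of w] permutations_of_setD(2)[OF that] by simp
  then show ?thesis
    unfolding ballot_avoiders_def by blast
qed

section \<open>Permutations determined by their relative order\<close>

lemma length_permutation: "w \<in> permutations_of_set {1..n} \<Longrightarrow> length w = n"
  using length_finite_permutations_of_set[of w "{1..n}"] by simp

text \<open>Each value from 1 to \<open>w ! i - 1\<close> occurs at exactly one position. This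
  recovers an entry from comparisons alone.\<close>

lemma nth_permutation_eq_rank:
  assumes "w \<in> permutations_of_set {1..n}" "i < n"
  shows "w ! i = Suc (card {j. j < n \<and> w ! j < w ! i})"
proof -
  have w: "set w = {1..n}" "distinct w" "length w = n"
    using assms(1) length_permutation by (auto dest: permutations_of_setD)
  then have wi: "w ! i \<in> {1..n}"
    using assms(2) nth_mem by metis
  have "(!) w ` {j. j < n \<and> w ! j < w ! i} = {x \<in> set w. x < w ! i}"
    using w(3) by (auto simp: set_conv_nth)
  also have "\<dots> = {1..<w ! i}"
    using w(1) wi by auto
  finally have "card {j. j < n \<and> w ! j < w ! i} = card {1..<w ! i}"
    using w by (metis (no_types, lifting) card_image inj_on_nth mem_Collect_eq)
  then show ?thesis
    using wi by auto
qed

lemma permutation_eqI: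
  assumes "v \<in> permutations_of_set {1..n}" "w \<in> permutations_of_set {1..n}"
    and less: "\<And>i j. i < j \<Longrightarrow> j < n \<Longrightarrow> v ! i < v ! j \<longleftrightarrow> w ! i < w ! j"
  shows "v = w"
proof (rule nth_equalityI)
  have len: "length v = n" "length w = n"
    using assms(1,2) length_permutation by blast+
  then show "length v = length w" by simp
  have dist: "distinct v" "distinct w"
    using assms(1,2) by (auto dest: permutations_of_setD)
  have "v ! j < v ! i \<longleftrightarrow> w ! j < w ! i" if "i < n" "j < n" for i j
  proof (cases "i < j")
    case True
    then have "v ! i \<noteq> v ! j" "w ! i \<noteq> w ! j"
      using that dist len by (simp_all add: nth_eq_iff_index_eq)
    then show ?thesis
      using less[OF True] that by linarith
  next
    case False
    then show ?thesis
      using less[of j i] that by (cases "i = j") auto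
  qed
  then have "{j. j < n \<and> v ! j < v ! i} = {j. j < n \<and> w ! j < w ! i}" if "i < n" for i
    using that by blast
  then show "v ! i = w ! i" if "i < length v" for i
    using nth_permutation_eq_rank[OF assms(1), of i] nth_permutation_eq_rank[OF assms(2), of i]
      that len by simp
qed

text \<open>\<open>layered\<close> fixes every comparison but the exempted one, which
  \<open>last\<close> supplies. This yields the upper bounds: one layered permutation for n = 1 or
  even n, and two for odd n at least 3.\<close>

lemma layered_eqI:
  assumes "v \<in> permutations_of_set {1..n}" "w \<in> permutations_of_set {1..n}" "layered v" "layered w"
    and last: "odd n \<Longrightarrow> n \<ge> 3 \<Longrightarrow> v ! (n - 3) < v ! (n - 1) \<longleftrightarrow> w ! (n - 3) < w ! (n - 1)"
  shows "v = w"
proof (rule permutation_eqI[OF assms(1,2)])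
  have len: "length v = n" "length w = n"
    using assms(1,2) length_permutation by blast+
  fix i j assume ij: "i < j" "j < n"
  show "v ! i < v ! j \<longleftrightarrow> w ! i < w ! j"
  proof (cases "even j \<and> Suc j = n \<and> j = i + 2")
    case True
    then have "odd n" "n \<ge> 3" "i = n - 3" "j = n - 1"
      by auto
    with last show ?thesis by simp
  next
    case False
    then show ?thesis
      using assms(3,4) ij len unfolding layered_def by simp
  qed
qed

section \<open>Explicit layered permutations\<close>

lemma map_upt_in_permutations:
  fixes f :: "nat \<Rightarrow> nat"
  assumes "inj_on f {..<n}" "\<And>i. i < n \<Longrightarrow> f i \<in> {1..n}"
  shows "map f [0..<n] \<in> permutations_of_set {1..n}"
proof (rule permutations_of_setI)
  \<comment> \<open>An injection into a set of the same finite size is onto.\<close>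
  have "f ` {..<n} = {1..n}"
    using assms by (intro card_subset_eq) (auto simp: card_image)
  then show "set (map f [0..<n]) = {1..n}"
    by (simp add: lessThan_atLeast0)
  show "distinct (map f [0..<n])"
    using assms(1) by (simp add: distinct_map lessThan_atLeast0)
qed

text \<open>With 0-based i and even n this is the word n-1, n, n-3, n-2, ..., 1, 2.\<close>

definition even_value :: "nat \<Rightarrow> nat \<Rightarrow> nat" where
  "even_value n i = (if even i then n - 1 - i else n + 1 - i)"

text \<open>For odd n at least 3 the word starts with n-1, n, n-3, n-2, ... and ends in 1, 3, 2 if
  \<open>up\<close> holds and in 2, 3, 1 otherwise. Thus \<open>up\<close> decides the exempted
  comparison.\<close>

definition odd_value :: "bool \<Rightarrow> nat \<Rightarrow> nat \<Rightarrow> nat" where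
  "odd_value up n i =
     (if Suc i = n then (if up then 2 else 1)
      else if up \<and> i + 3 = n then 1
      else even_value n i)"

lemma parity_cases:
  fixes i :: nat
  obtains a where "i = 2 * a" | a where "i = 2 * a + 1"
  by (cases "even i") (auto elim: evenE oddE)

lemma even_value_less_iff:
  assumes "i < j" "j < 2 * m"
  shows "even_value (2 * m) i < even_value (2 * m) j \<longleftrightarrow> even i \<and> j = Suc i"
  using assms
  by (cases i rule: parity_cases; cases j rule: parity_cases;
      simp add: even_value_def; (linarith | presburger)?)

lemma even_value_neq:
  assumes "i < j" "j < 2 * m"
  shows "even_value (2 * m) i \<noteq> even_value (2 * m) j"
  using assms
  by (cases i rule: parity_cases; cases j rule: parity_cases;
      simp add: even_value_def; (linarith | presburger)?)

lemma even_value_in_range: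
  assumes "i < 2 * m"
  shows "even_value (2 * m) i \<in> {1..2 * m}"
  using assms
  by (cases i rule: parity_cases; simp add: even_value_def; (linarith | presburger)?)

lemma odd_value_less_iff:
  assumes "i < j" "j < 2 * m + 3" "\<not> (even j \<and> Suc j = 2 * m + 3 \<and> j = i + 2)"
  shows "odd_value up (2 * m + 3) i < odd_value up (2 * m + 3) j \<longleftrightarrow> even i \<and> j = Suc i"
  using assms
  by (cases i rule: parity_cases; cases j rule: parity_cases; cases up;
      simp add: odd_value_def even_value_def; (linarith | presburger)?)

lemma odd_value_neq:
  assumes "i < j" "j < 2 * m + 3"
  shows "odd_value up (2 * m + 3) i \<noteq> odd_value up (2 * m + 3) j"
  using assms
  by (cases i rule: parity_cases; cases j rule: parity_cases; cases up;
      simp add: odd_value_def even_value_def; (linarith | presburger)?)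

lemma odd_value_in_range:
  assumes "i < 2 * m + 3"
  shows "odd_value up (2 * m + 3) i \<in> {1..2 * m + 3}"
  using assms
  by (cases i rule: parity_cases; cases up;
      simp add: odd_value_def even_value_def; (linarith | presburger)?)

lemma even_layered:
  assumes "even n"
  shows "map (even_value n) [0..<n] \<in> permutations_of_set {1..n}"
    and "layered (map (even_value n) [0..<n])"
proof -
  obtain m where n: "n = 2 * m"
    using assms by blast
  have "inj_on (even_value n) {..<n}"
    unfolding n by (rule linorder_inj_onI') (simp add: even_value_neq)
  then show "map (even_value n) [0..<n] \<in> permutations_of_set {1..n}"
    using even_value_in_range unfolding n by (intro map_upt_in_permutations) blast+
  show "layered (map (even_value n) [0..<n])"
    unfolding n layered_def using even_value_less_iff[of _ _ m] by simp
qed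

lemma odd_layered:
  assumes "odd n" "n \<ge> 3"
  shows "map (odd_value up n) [0..<n] \<in> permutations_of_set {1..n}"
    and "layered (map (odd_value up n) [0..<n])"
    and "map (odd_value up n) [0..<n] ! (n - 3) < map (odd_value up n) [0..<n] ! (n - 1) \<longleftrightarrow> up"
proof -
  have "\<exists>m. n = 2 * m + 3"
    using assms by presburger
  then obtain m where n: "n = 2 * m + 3"
    by blast
  have "inj_on (odd_value up n) {..<n}"
    unfolding n by (rule linorder_inj_onI') (simp add: odd_value_neq)
  then show "map (odd_value up n) [0..<n] \<in> permutations_of_set {1..n}"
    using odd_value_in_range unfolding n by (intro map_upt_in_permutations) blast+
  show "layered (map (odd_value up n) [0..<n])"
    unfolding layered_def
  proof (intro allI impI)
    fix i j
    assume "i < j" "j < length (map (odd_value up n) [0..<n])"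
      "\<not> (even j \<and> Suc j = length (map (odd_value up n) [0..<n]) \<and> j = i + 2)"
    then show "map (odd_value up n) [0..<n] ! i < map (odd_value up n) [0..<n] ! j \<longleftrightarrow>
        even i \<and> j = Suc i"
      using odd_value_less_iff[of i j m up] by (simp add: n del: upt_Suc)
  qed
  show "map (odd_value up n) [0..<n] ! (n - 3) < map (odd_value up n) [0..<n] ! (n - 1) \<longleftrightarrow> up"
    by (simp add: odd_value_def even_value_def n del: upt_Suc)
qed

theorem theorem3p3:
  fixes n :: nat
  assumes "n \<ge> 1"
  shows "card (ballot_avoiders n {[1, 2, 3], [2, 1, 3]}) = (if n = 1 \<or> even n then 1 else 2)"
proof -
  let ?B = "{w \<in> permutations_of_set {1..n}. layered w}"
  consider "n = 1" | "even n" | "odd n" "n \<ge> 3"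
    using assms by (cases "n = 1"; cases "n = 2") auto
  then have "card ?B = (if n = 1 \<or> even n then 1 else 2)"
  proof cases
    case 1
    then have "?B = {[1]}"
      by (auto simp: layered_def)
    with 1 show ?thesis by simp
  next
    case 2
    have "?B = {map (even_value n) [0..<n]}"
      using layered_eqI[of _ n] even_layered[OF 2] 2 by blast
    with 2 show ?thesis by simp
  next
    case 3
    let ?w = "\<lambda>up. map (odd_value up n) [0..<n]"
    have "?B = {?w True, ?w False}"
    proof (intro equalityI subsetI)
      fix v assume "v \<in> ?B"
      \<comment> \<open>Taking \<open>up\<close> to be the outcome of the open comparison in v
        itself makes both permutations agree on it.\<close>
      then have "v = ?w (v ! (n - 3) < v ! (n - 1))"
        using odd_layered[OF 3] by (intro layered_eqI[of _ n]) blast+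
      then show "v \<in> {?w True, ?w False}"
        by (cases "v ! (n - 3) < v ! (n - 1)") auto
    qed (use odd_layered(1,2)[OF 3] in blast)
    moreover have "?w True \<noteq> ?w False"
      using odd_layered(3)[OF 3] by metis
    ultimately show ?thesis
      using 3 by simp
  qed
  then show ?thesis
    by (simp only: ballot_avoiders_eq_layered)
qed

end
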